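(* Let $X$ and $Y$ be real-valued random variables defined on a common probability space $(\Omega,\Sigma,\mathbb{P})$, and let $\mathcal{K}=\{[a,b]\colon a,b\in\mathbb{R},\ a<b\}$. Then the following conditions are equivalent: 1) $X$ and $Y$ are independent; 2) for any event $U=\{X\in A,\ Y\in B\}$ with $A,B\in\mathcal{K}$ and $\mathbb{P}[X\in A,\ Y\in B]>0$, $$E[XY|U]=E[X|U]\cdot E[Y|U].$$ Moreover, under the additional assumption that $E|X|<\infty$ and $E|Y|<\infty$, the same equivalence holds when the family of bounded intervals is replaced with the family of half-bounded intervals $\mathcal{K}=\{[t,\infty)\colon t\in\mathbb{R}\}$.
   Context: For an event $U\in\Sigma$ with $\mathbb{P}[U]>0$, $\mathbb{P}[\cdot|U]$ is the conditional probability measure $\mathbb{P}[C|U]=\mathbb{P}[C\cap U]/\mathbb{P}[U]$, and $E[Z|U]=\int_\Omega Z\,d\mathbb{P}[\cdot|U]=E[Z\cdot 1_U]/\mathbb{P}[U]$ denotes the (elementary) conditional expectation given the event $U$. Independence of $X$ and $Y$ means $\mathbb{P}_{(X,Y)}=\mathbb{P}_X\otimes\mathbb{P}_Y$, where $\mathbb{P}_Z$ denotes the distribution of $Z$. In the half-bounded case, the equality in condition 2) is understood to include that $E[XY|U]$ exists and is finite, i.e. $E[|XY|1_U]<\infty$. *)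

theory Defs
  imports "HOL-Probability.Probability"
begin

text \<open>
  \<open>uniform_measure M U\<close> is the conditional probability measure
  \<open>C \<mapsto> P(C \<inter> U) / P(U)\<close> given the event \<open>U\<close>, see \<open>measure_uniform_measure\<close>.
\<close>
definition event_cond_exp :: "'a measure \<Rightarrow> ('a \<Rightarrow> real) \<Rightarrow> 'a set \<Rightarrow> real" where
  "event_cond_exp M Z U = integral\<^sup>L (uniform_measure M U) Z"

lemma (in prob_space) uniform_measure_eq_density:
  assumes "prob U > 0"
  shows "uniform_measure M U = density M (\<lambda>\<omega>. ennreal (indicator U \<omega> / prob U))"
  using assms unfolding uniform_measure_def emeasure_eq_measure
  by (intro arg_cong[where f = "density M"] ext)
     (auto simp: divide_ennreal ennreal_1[symmetric] simp del: ennreal_1 split: split_indicator)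

lemma (in prob_space) event_cond_exp_eq:
  assumes U: "prob U > 0" and Z: "Z \<in> borel_measurable M"
  shows "event_cond_exp M Z U = expectation (\<lambda>\<omega>. Z \<omega> * indicator U \<omega>) / prob U"
proof -
  have [measurable]: "U \<in> events"
    using U measure_notin_sets by fastforce
  have "event_cond_exp M Z U = expectation (\<lambda>\<omega>. (indicator U \<omega> / prob U) *\<^sub>R Z \<omega>)"
    unfolding event_cond_exp_def uniform_measure_eq_density[OF U]
    using Z by (intro integral_density) auto
  then show ?thesis
    by (simp add: mult.commute)
qed

lemma (in prob_space) integrable_uniform_measure_iff:
  fixes Z :: "'a \<Rightarrow> real"
  assumes U: "prob U > 0" and Z: "Z \<in> borel_measurable M"
  shows "integrable (uniform_measure M U) Z \<longleftrightarrow> integrable M (\<lambda>\<omega>. \<bar>Z \<omega>\<bar> * indicator U \<omega>)"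
proof -
  have [measurable]: "U \<in> events"
    using U measure_notin_sets by fastforce
  note [measurable] = Z
  have "integrable (uniform_measure M U) Z
      \<longleftrightarrow> integrable M (\<lambda>\<omega>. (indicator U \<omega> / prob U) *\<^sub>R Z \<omega>)"
    unfolding uniform_measure_eq_density[OF U]
    using Z by (intro integrable_density) auto
  also have "\<dots> \<longleftrightarrow> integrable M (\<lambda>\<omega>. Z \<omega> * indicator U \<omega>)"
    using U integrable_mult_left_iff[of M "1 / prob U" "\<lambda>\<omega>. Z \<omega> * indicator U \<omega>"]
    by (simp add: mult.commute)
  also have "\<dots> \<longleftrightarrow> integrable M (\<lambda>\<omega>. \<bar>Z \<omega> * indicator U \<omega>\<bar>)"
    by (intro integrable_abs_iff[symmetric]) measurable
  finally show ?thesis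
    by (simp add: abs_mult)
qed

definition bounded_intervals :: "real set set" where
  "bounded_intervals = {{a..b} | a b. a < b}"

definition half_bounded_intervals :: "real set set" where
  "half_bounded_intervals = {{t..} | t. True}"

definition rect_event :: "'a measure \<Rightarrow> ('a \<Rightarrow> real) \<Rightarrow> ('a \<Rightarrow> real) \<Rightarrow> real set \<Rightarrow> real set \<Rightarrow> 'a set"
  where "rect_event M X Y A B = {\<omega> \<in> space M. X \<omega> \<in> A \<and> Y \<omega> \<in> B}"

end

theory Submission
  imports Defs
begin

text \<open>
  The forward direction is the product rule for expectations of functions of independent variables.
  The converse rests on a fact about a single real variable \<open>Z\<close> and two nonnegative weights
  \<open>V\<close>, \<open>W\<close>. Put \<open>F t = E[V; Z \<ge> t]\<close> and \<open>\<Phi> t = E[V (Z - t)\<^sup>+]\<close>, so that \<open>\<Phi>\<close> is the integral of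
  \<open>F\<close> over \<open>[t, \<infinity>)\<close>, and define \<open>G\<close>, \<open>\<Psi>\<close> from \<open>W\<close> in the same way. If the weighted means of
  \<open>Z - t\<close> on \<open>{Z \<ge> t}\<close> agree for every \<open>t\<close>, that is, \<open>F \<Psi> = G \<Phi>\<close>, then \<open>\<Psi> / \<Phi>\<close> has derivative
  \<open>(F \<Psi> - G \<Phi>) / \<Phi>\<^sup>2 = 0\<close> wherever \<open>\<Phi> > 0\<close>, hence \<open>\<Psi>\<close> and \<open>\<Phi>\<close> are proportional, and so are
  \<open>G\<close> and \<open>F\<close>. This is \<open>integrated_tails_proportional\<close>, and
  \<open>tail_expectations_proportional\<close> in its probabilistic form.

  Conditional covariances do not change when \<open>X\<close> and \<open>Y\<close> are shifted by constants. On the quadrant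
  \<open>U = {X \<ge> s, Y \<ge> t}\<close>, the vanishing of the covariance therefore says
  \<open>P(U) E[(X-s)\<^sup>+ (Y-t)\<^sup>+] = E[(X-s)\<^sup>+; Y \<ge> t] E[(Y-t)\<^sup>+; X \<ge> s]\<close>.
  For fixed \<open>s\<close> this is the one-variable hypothesis for \<open>Z = Y\<close> with the weights \<open>1{X \<ge> s}\<close> and
  \<open>(X-s)\<^sup>+\<close>. Its conclusion,
  \<open>P(U) E[(X-s)\<^sup>+] = P(X \<ge> s) E[(X-s)\<^sup>+; Y \<ge> t]\<close>,
  is for fixed \<open>t\<close> the one-variable hypothesis for \<open>Z = X\<close> with the weights \<open>1\<close> and \<open>1{Y \<ge> t}\<close>;
  a second application gives \<open>P(U) = P(X \<ge> s) P(Y \<ge> t)\<close>, and closed quadrants generate the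
  product structure.

  Both families of intervals are covered by running this argument with an extra weight \<open>w\<close>
  (\<open>tails_factor_if_shifted_products_factor\<close>). Half-bounded intervals correspond to \<open>w = 1\<close>. For
  bounded intervals \<open>w\<close> is the indicator of \<open>{X \<le> n, Y \<le> n}\<close>, which cuts a quadrant down to a bounded
  rectangle; one then lets \<open>n\<close> tend to infinity.
\<close>

section \<open>Tail functions with proportional integrals\<close>

text \<open>
  Splitting \<open>[a, b]\<close> into \<open>n\<close> equal pieces and adding up the bounds gives
  \<open>\<bar>U a - U b\<bar> \<le> (b - a) (H a - H b) / n\<close>. This replaces the argument "derivative zero, hence
  constant" for ratios of integrals of tails, whose factors have only one-sided derivatives where a
  tail jumps.
\<close>
lemma eq_if_increments_le_length_times_decrease:
  fixes U H :: "real \<Rightarrow> real"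
  assumes "a \<le> b"
    and inc: "\<And>x y. a \<le> x \<Longrightarrow> x \<le> y \<Longrightarrow> y \<le> b \<Longrightarrow> \<bar>U x - U y\<bar> \<le> (y - x) * (H x - H y)"
  shows "U a = U b"
proof -
  have bound: "\<bar>U a - U b\<bar> \<le> (b - a) * (H a - H b) / real (Suc n)" for n
  proof -
    define h where "h = (b - a) / real (Suc n)"
    define x where "x i = a + real i * h" for i
    have h: "0 \<le> h" and hn: "real (Suc n) * h = b - a"
      using \<open>a \<le> b\<close> by (simp_all add: h_def)
    have ends: "x 0 = a" "x (Suc n) = b"
      using hn by (simp_all add: x_def)
    have step: "\<bar>U (x i) - U (x (Suc i))\<bar> \<le> h * (H (x i) - H (x (Suc i)))" if "i < Suc n" for i
    proof -
      have "real (Suc i) * h \<le> real (Suc n) * h"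
        using that h by (intro mult_right_mono) auto
      then have "x (Suc i) \<le> b"
        using hn by (simp add: x_def)
      moreover have "a \<le> x i" "x (Suc i) - x i = h"
        using h by (simp_all add: x_def algebra_simps)
      ultimately show ?thesis
        using inc[of "x i" "x (Suc i)"] h by simp
    qed
    have "U a - U b = (\<Sum>i<Suc n. U (x i) - U (x (Suc i)))"
      unfolding sum_lessThan_telescope'[of "\<lambda>i. U (x i)"] ends ..
    then have "\<bar>U a - U b\<bar> \<le> (\<Sum>i<Suc n. h * (H (x i) - H (x (Suc i))))"
      using step by (auto intro!: order_trans[OF sum_abs] sum_mono simp del: sum.lessThan_Suc)
    also have "\<dots> = h * (H a - H b)"
      unfolding sum_distrib_left[symmetric] sum_lessThan_telescope'[of "\<lambda>i. H (x i)"] ends ..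
    finally show ?thesis
      by (simp add: h_def)
  qed
  have "(\<lambda>n. (b - a) * (H a - H b) / real (Suc n)) \<longlonglongrightarrow> 0"
    by (rule LIMSEQ_Suc[OF lim_const_over_n])
  then have "\<bar>U a - U b\<bar> \<le> 0"
    by (rule LIMSEQ_le_const) (use bound in blast)
  then show ?thesis by simp
qed

text \<open>
  This expresses that \<open>F\<close> is the left-continuous tail \<open>t \<mapsto> \<nu> [t, \<infinity>)\<close> of a measure \<open>\<nu>\<close>, and \<open>\<Phi>\<close> an
  antiderivative of \<open>- F\<close>. Bounding the increments of \<open>\<Phi>\<close> on each interval by the
  extreme values of \<open>F\<close> encodes the integral without integrating, and makes \<open>F\<close> antitone, so that
  convergence along the single sequence \<open>t - 1/(n+1)\<close> amounts to left continuity.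
\<close>
definition integrated_tail :: "(real \<Rightarrow> real) \<Rightarrow> (real \<Rightarrow> real) \<Rightarrow> bool" where
  "integrated_tail F \<Phi> \<longleftrightarrow>
     (\<forall>t. 0 \<le> F t \<and> 0 \<le> \<Phi> t) \<and>
     (\<forall>s t. s \<le> t \<longrightarrow> (t - s) * F t \<le> \<Phi> s - \<Phi> t \<and> \<Phi> s - \<Phi> t \<le> (t - s) * F s) \<and>
     (\<forall>t. (\<lambda>n. F (t - 1 / real (Suc n))) \<longlonglongrightarrow> F t)"

lemma
  assumes "integrated_tail F \<Phi>"
  shows integrated_tail_nonneg: "0 \<le> F t" "0 \<le> \<Phi> t"
    and integrated_tail_lower: "s \<le> t \<Longrightarrow> (t - s) * F t \<le> \<Phi> s - \<Phi> t"
    and integrated_tail_upper: "s \<le> t \<Longrightarrow> \<Phi> s - \<Phi> t \<le> (t - s) * F s"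
    and integrated_tail_left_continuous: "(\<lambda>n. F (t - 1 / real (Suc n))) \<longlonglongrightarrow> F t"
  using assms by (auto simp: integrated_tail_def)

lemma integrated_tail_antimono:
  assumes "integrated_tail F \<Phi>" "s \<le> t"
  shows "\<Phi> t \<le> \<Phi> s"
proof -
  have "0 \<le> (t - s) * F t"
    using assms integrated_tail_nonneg(1)[OF assms(1)] by simp
  then show ?thesis
    using integrated_tail_lower[OF assms] by linarith
qed

lemma integrated_tail_add:
  assumes "integrated_tail F \<Phi>" "integrated_tail G \<Psi>"
  shows "integrated_tail (\<lambda>t. F t + G t) (\<lambda>t. \<Phi> t + \<Psi> t)"
  using assms unfolding integrated_tail_def
  by (auto intro!: tendsto_add simp: distrib_left add_diff_add add_mono)

lemma integrated_tail_scale: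
  assumes "integrated_tail F \<Phi>" "0 \<le> k"
  shows "integrated_tail (\<lambda>t. k * F t) (\<lambda>t. k * \<Phi> t)"
proof -
  have "k * ((t - s) * F t) \<le> k * (\<Phi> s - \<Phi> t)" "k * (\<Phi> s - \<Phi> t) \<le> k * ((t - s) * F s)"
    if "s \<le> t" for s t
    using assms that by (auto intro!: mult_left_mono simp: integrated_tail_def)
  then show ?thesis
    using assms unfolding integrated_tail_def
    by (auto intro!: tendsto_mult_left simp: algebra_simps)
qed

text \<open>
  By left continuity, \<open>F\<close> is minus the left derivative of \<open>\<Phi>\<close>. The difference quotient over
  \<open>[t - 1/(n+1), t]\<close> lies between the values of any such tail at the two end points.
\<close>
lemma integrated_tail_unique:
  assumes F: "integrated_tail F \<Phi>" and G: "integrated_tail G \<Phi>"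
  shows "F t = G t"
proof -
  have "G t \<le> F t" if F: "integrated_tail F \<Phi>" and G: "integrated_tail G \<Phi>" for F G
  proof (rule LIMSEQ_le_const[OF integrated_tail_left_continuous[OF F]], intro exI allI impI)
    fix n
    let ?s = "t - 1 / real (Suc n)"
    have "(t - ?s) * G t \<le> (t - ?s) * F ?s"
      using integrated_tail_lower[OF G, of ?s t] integrated_tail_upper[OF F, of ?s t] by simp
    then show "G t \<le> F ?s"
      by (rule mult_left_le_imp_le) simp
  qed
  from this[OF F G] this[OF G F] show ?thesis by simp
qed

text \<open>
  The quotient rule in finite form. With \<open>\<Psi>' = - G\<close> and \<open>\<Phi>' = - F\<close> the numerator
  \<open>G \<Phi> - F \<Psi>\<close> of \<open>- (\<Psi> / \<Phi>)'\<close> vanishes, so over \<open>[x, y]\<close> only the variation of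
  \<open>F\<close> and \<open>G\<close> contributes, times the length \<open>y - x\<close>.
\<close>
lemma integrated_tail_ratio_constant:
  assumes F: "integrated_tail F \<Phi>" and G: "integrated_tail G \<Psi>"
    and le: "\<And>t. \<Psi> t \<le> \<Phi> t"
    and eq: "\<And>t. F t * \<Psi> t = G t * \<Phi> t"
    and "s \<le> t" "0 < \<Phi> t"
  shows "\<Psi> s / \<Phi> s = \<Psi> t / \<Phi> t"
proof -
  define H where "H x = (F x + G x) / \<Phi> t" for x
  show ?thesis
  proof (rule eq_if_increments_le_length_times_decrease[where H = H, OF \<open>s \<le> t\<close>])
    fix x y assume xy: "s \<le> x" "x \<le> y" "y \<le> t"
    let ?P = "\<Psi> x * \<Phi> y - \<Psi> y * \<Phi> x" and ?D = "(F x + G x) - (F y + G y)"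
    have pos: "0 < \<Phi> y" "0 < \<Phi> x" "\<Phi> t \<le> \<Phi> x"
      using integrated_tail_antimono[OF F, of y t] integrated_tail_antimono[OF F, of x t] xy
        \<open>0 < \<Phi> t\<close> by auto
    have \<Psi>: "0 \<le> \<Psi> y"
      by (rule integrated_tail_nonneg[OF G])
    have mono: "0 \<le> (y - x) * (F x - F y)" "0 \<le> (y - x) * (G x - G y)"
      using integrated_tail_lower[OF F xy(2)] integrated_tail_upper[OF F xy(2)]
        integrated_tail_lower[OF G xy(2)] integrated_tail_upper[OF G xy(2)]
      by (auto simp: right_diff_distrib)
    have "?P = (\<Psi> x - \<Psi> y) * \<Phi> y - \<Psi> y * (\<Phi> x - \<Phi> y)"
      by (simp add: algebra_simps)
    also have "\<dots> \<le> ((y - x) * G x) * \<Phi> y - \<Psi> y * ((y - x) * F y)"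
      using integrated_tail_upper[OF G xy(2)] integrated_tail_lower[OF F xy(2)] pos \<Psi>
      by (intro diff_mono mult_right_mono mult_left_mono) auto
    also have "\<dots> = ((y - x) * (G x - G y)) * \<Phi> y"
      using eq[of y] by (simp add: algebra_simps)
    finally have upper: "?P \<le> ((y - x) * (G x - G y)) * \<Phi> y" .
    have "- ?P = \<Psi> y * (\<Phi> x - \<Phi> y) - (\<Psi> x - \<Psi> y) * \<Phi> y"
      by (simp add: algebra_simps)
    also have "\<dots> \<le> \<Psi> y * ((y - x) * F x) - ((y - x) * G y) * \<Phi> y"
      using integrated_tail_lower[OF G xy(2)] integrated_tail_upper[OF F xy(2)] pos \<Psi>
      by (intro diff_mono mult_right_mono mult_left_mono) auto
    also have "\<dots> = ((y - x) * (F x - F y)) * \<Psi> y"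
    proof -
      have "(y - x) * G y * \<Phi> y = (y - x) * (F y * \<Psi> y)"
        using eq[of y] by simp
      then show ?thesis by (simp add: algebra_simps)
    qed
    also have "\<dots> \<le> ((y - x) * (F x - F y)) * \<Phi> y"
      by (intro mult_left_mono le mono)
    finally have lower: "- ?P \<le> ((y - x) * (F x - F y)) * \<Phi> y" .
    have "\<bar>?P\<bar> \<le> ((y - x) * (F x - F y)) * \<Phi> y + ((y - x) * (G x - G y)) * \<Phi> y"
      using upper lower mult_nonneg_nonneg[OF mono(1), of "\<Phi> y"]
        mult_nonneg_nonneg[OF mono(2), of "\<Phi> y"] pos by linarith
    also have "\<dots> = ((y - x) * ?D) * \<Phi> y"
      by (simp add: algebra_simps)
    finally have P: "\<bar>?P\<bar> \<le> ((y - x) * ?D) * \<Phi> y" .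
    have "\<bar>\<Psi> x / \<Phi> x - \<Psi> y / \<Phi> y\<bar> = \<bar>?P\<bar> / (\<Phi> x * \<Phi> y)"
      using pos by (simp add: diff_frac_eq abs_mult)
    also have "\<dots> \<le> ((y - x) * ?D) * \<Phi> y / (\<Phi> x * \<Phi> y)"
      using P pos by (intro divide_right_mono) auto
    also have "\<dots> = ((y - x) * ?D) / \<Phi> x"
      using pos by simp
    also have "\<dots> \<le> ((y - x) * ?D) / \<Phi> t"
      using mono pos \<open>0 < \<Phi> t\<close> by (intro divide_left_mono) (auto simp: algebra_simps)
    also have "\<dots> = (y - x) * (H x - H y)"
      by (simp add: H_def diff_divide_distrib[symmetric])
    finally show "\<bar>\<Psi> x / \<Phi> x - \<Psi> y / \<Phi> y\<bar> \<le> (y - x) * (H x - H y)" .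
  qed
qed

text \<open>
  The ratio \<open>\<Psi> / \<Phi>\<close> is meaningless where \<open>\<Phi>\<close> vanishes, and \<open>\<Psi>\<close> might be positive there. Comparing \<open>\<Psi>\<close>
  with \<open>\<Sigma> = \<Phi> + \<Psi>\<close> instead preserves the hypothesis and removes this problem, because \<open>\<Sigma> t = 0\<close>
  forces \<open>\<Psi> t = 0\<close>. Thus \<open>\<Psi> = k \<Sigma>\<close> on the whole line, and uniqueness of the tail yields
  \<open>G = k (F + G)\<close>.
\<close>
lemma integrated_tails_proportional:
  assumes F: "integrated_tail F \<Phi>" and G: "integrated_tail G \<Psi>"
    and eq: "\<And>t. F t * \<Psi> t = G t * \<Phi> t"
  shows "F s * G t = F t * G s"
proof -
  define S \<Sigma> where "S = (\<lambda>t. F t + G t)" and "\<Sigma> = (\<lambda>t. \<Phi> t + \<Psi> t)"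
  have S: "integrated_tail S \<Sigma>"
    unfolding S_def \<Sigma>_def by (rule integrated_tail_add[OF F G])
  have le: "\<Psi> t \<le> \<Sigma> t" for t
    using integrated_tail_nonneg(2)[OF F] by (simp add: \<Sigma>_def)
  have eqS: "S t * \<Psi> t = G t * \<Sigma> t" for t
    using eq[of t] by (simp add: S_def \<Sigma>_def algebra_simps)
  have zero: "\<Psi> t = 0" if "\<not> 0 < \<Sigma> t" for t
    using that le[of t] integrated_tail_nonneg(2)[OF G, of t] by linarith
  have "\<exists>k\<ge>0. \<forall>t. \<Psi> t = k * \<Sigma> t"
  proof (cases "\<exists>r. 0 < \<Sigma> r")
    case True
    then obtain r where r: "0 < \<Sigma> r" by blast
    have "\<Psi> t = \<Psi> r / \<Sigma> r * \<Sigma> t" for t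
    proof (cases "0 < \<Sigma> t")
      case pos: True
      have "\<Psi> t / \<Sigma> t = \<Psi> r / \<Sigma> r"
        using integrated_tail_ratio_constant[OF S G le eqS _ r, of t]
          integrated_tail_ratio_constant[OF S G le eqS _ pos, of r]
        by (metis linear)
      then show ?thesis
        using pos by (simp add: field_simps)
    next
      case False
      then show ?thesis
        using zero[OF False] integrated_tail_nonneg(2)[OF S, of t] by simp
    qed
    moreover have "0 \<le> \<Psi> r / \<Sigma> r"
      using r integrated_tail_nonneg(2)[OF G] by simp
    ultimately show ?thesis by blast
  next
    case False
    then show ?thesis
      using zero by (intro exI[of _ 0]) auto
  qed
  then obtain k where k: "0 \<le> k" "\<Psi> = (\<lambda>t. k * \<Sigma> t)" by auto
  have "G t = k * S t" for t
    using integrated_tail_unique[OF G[unfolded k(2)] integrated_tail_scale[OF S k(1)]] .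
  then have "S s * G t = S t * G s"
    by simp
  then show ?thesis
    by (simp add: S_def algebra_simps)
qed

section \<open>Weighted tail expectations\<close>

lemma tendsto_integral_mult_indicator:
  fixes V :: "'a \<Rightarrow> real"
  assumes V: "integrable M V" and A: "\<And>n. A n \<in> sets M" and B: "B \<in> sets M"
    and lim: "\<And>x. x \<in> space M \<Longrightarrow> eventually (\<lambda>n. x \<in> A n \<longleftrightarrow> x \<in> B) sequentially"
  shows "(\<lambda>n. \<integral>x. V x * indicator (A n) x \<partial>M) \<longlonglongrightarrow> (\<integral>x. V x * indicator B x \<partial>M)"
proof (rule integral_dominated_convergence[where w = "\<lambda>x. \<bar>V x\<bar>"])
  note [measurable] = A B borel_measurable_integrable[OF V]
  show "(\<lambda>x. V x * indicator (A n) x) \<in> borel_measurable M" for n by measurable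
  show "(\<lambda>x. V x * indicator B x) \<in> borel_measurable M" by measurable
  show "AE x in M. (\<lambda>n. V x * indicator (A n) x) \<longlonglongrightarrow> V x * indicator B x"
  proof (rule AE_I2)
    fix x assume "x \<in> space M"
    then have "eventually (\<lambda>n. x \<in> A n \<longleftrightarrow> x \<in> B) sequentially"
      by (rule lim)
    then have "eventually (\<lambda>n. V x * indicator (A n) x = V x * indicator B x) sequentially"
      by (rule eventually_mono) (simp add: indicator_def)
    then show "(\<lambda>n. V x * indicator (A n) x) \<longlonglongrightarrow> V x * indicator B x"
      by (rule tendsto_eventually)
  qed
  show "AE x in M. norm (V x * indicator (A n) x) \<le> \<bar>V x\<bar>" for n
    by (auto simp: indicator_def)
qed (use V in auto)

lemma eventually_le_sub_inverse_iff:
  fixes z t :: real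
  shows "eventually (\<lambda>n. t - 1 / real (Suc n) \<le> z \<longleftrightarrow> t \<le> z) sequentially"
proof (cases "t \<le> z")
  case True
  have "t - 1 / real (Suc n) \<le> z" for n
    using True by (rule order_trans[rotated]) simp
  then show ?thesis using True by simp
next
  case False
  have "(\<lambda>n. t - 1 / real (Suc n)) \<longlonglongrightarrow> t - 0"
    by (intro tendsto_intros LIMSEQ_Suc[OF lim_const_over_n])
  then have "eventually (\<lambda>n. z < t - 1 / real (Suc n)) sequentially"
    using False by (intro order_tendstoD(1)[where y = t]) auto
  then show ?thesis
    using False by (auto elim: eventually_mono)
qed

text \<open>
  For \<open>s \<le> t\<close> the function \<open>(z - s)\<^sup>+ - (z - t)\<^sup>+\<close> lies between \<open>(t - s) 1{z \<ge> t}\<close> and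
  \<open>(t - s) 1{z \<ge> s}\<close>.
\<close>
lemma integrated_tail_expectation:
  fixes V Z :: "'a \<Rightarrow> real"
  assumes V: "integrable M V" "\<And>x. 0 \<le> V x" and Z[measurable]: "Z \<in> borel_measurable M"
    and pos: "\<And>t. integrable M (\<lambda>x. V x * max 0 (Z x - t))"
  shows "integrated_tail (\<lambda>t. \<integral>x. V x * indicator {t..} (Z x) \<partial>M)
    (\<lambda>t. \<integral>x. V x * max 0 (Z x - t) \<partial>M)"
  unfolding integrated_tail_def
proof (intro conjI allI impI)
  note [measurable] = borel_measurable_integrable[OF V(1)]
  have ind: "integrable M (\<lambda>x. V x * indicator {t..} (Z x))" for t
    by (rule Bochner_Integration.integrable_bound[OF V(1)]) (auto simp: indicator_def)
  show "0 \<le> (\<integral>x. V x * indicator {t..} (Z x) \<partial>M)" "0 \<le> (\<integral>x. V x * max 0 (Z x - t) \<partial>M)" for t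
    using V(2) by (auto intro!: integral_nonneg)
  fix s t :: real assume st: "s \<le> t"
  have diff: "(\<integral>x. V x * max 0 (Z x - s) \<partial>M) - (\<integral>x. V x * max 0 (Z x - t) \<partial>M) =
      (\<integral>x. V x * (max 0 (Z x - s) - max 0 (Z x - t)) \<partial>M)"
    using pos by (simp add: right_diff_distrib)
  have int: "integrable M (\<lambda>x. V x * (max 0 (Z x - s) - max 0 (Z x - t)))"
    using pos by (simp add: right_diff_distrib)
  have "(t - s) * (\<integral>x. V x * indicator {t..} (Z x) \<partial>M) =
      (\<integral>x. V x * ((t - s) * indicator {t..} (Z x)) \<partial>M)"
    by (simp add: mult.left_commute[of "V _" "t - s"])
  also have "\<dots> \<le> (\<integral>x. V x * (max 0 (Z x - s) - max 0 (Z x - t)) \<partial>M)"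
    using V(2) st ind[of t] int
    by (intro integral_mono mult_left_mono) (auto simp: mult.left_commute[of "V _" "t - s"] indicator_def max_def)
  finally show "(t - s) * (\<integral>x. V x * indicator {t..} (Z x) \<partial>M)
      \<le> (\<integral>x. V x * max 0 (Z x - s) \<partial>M) - (\<integral>x. V x * max 0 (Z x - t) \<partial>M)"
    by (simp only: diff)
  have "(\<integral>x. V x * (max 0 (Z x - s) - max 0 (Z x - t)) \<partial>M)
      \<le> (\<integral>x. V x * ((t - s) * indicator {s..} (Z x)) \<partial>M)"
    using V(2) st ind[of s] int
    by (intro integral_mono mult_left_mono) (auto simp: mult.left_commute[of "V _" "t - s"] indicator_def max_def)
  also have "\<dots> = (t - s) * (\<integral>x. V x * indicator {s..} (Z x) \<partial>M)"
    by (simp add: mult.left_commute[of "V _" "t - s"])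
  finally show "(\<integral>x. V x * max 0 (Z x - s) \<partial>M) - (\<integral>x. V x * max 0 (Z x - t) \<partial>M)
      \<le> (t - s) * (\<integral>x. V x * indicator {s..} (Z x) \<partial>M)"
    by (simp only: diff)
next
  fix t
  have ind: "indicator {s..} (Z x) = (indicator {x \<in> space M. s \<le> Z x} x :: real)"
    if "x \<in> space M" for s x
    using that by (simp add: indicator_def)
  have eq: "(\<integral>x. V x * indicator {s..} (Z x) \<partial>M) = (\<integral>x. V x * indicator {x \<in> space M. s \<le> Z x} x \<partial>M)"
    for s
    by (intro Bochner_Integration.integral_cong refl arg_cong2[where f = "(*)"] ind)
  show "(\<lambda>n. \<integral>x. V x * indicator {t - 1 / real (Suc n)..} (Z x) \<partial>M)
      \<longlonglongrightarrow> (\<integral>x. V x * indicator {t..} (Z x) \<partial>M)"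
    unfolding eq
    using eventually_le_sub_inverse_iff[of t]
    by (intro tendsto_integral_mult_indicator V) (auto elim: eventually_mono)
qed

text \<open>
  The hypothesis says that \<open>Z - t\<close> has the same mean over \<open>{Z \<ge> t}\<close> under the weights \<open>V\<close> and \<open>W\<close>,
  cleared of denominators. The constant of proportionality between the tails is identified by
  letting the threshold tend to \<open>- \<infinity>\<close>.
\<close>
lemma tail_expectations_proportional:
  fixes V W Z :: "'a \<Rightarrow> real"
  assumes V: "integrable M V" "\<And>x. 0 \<le> V x" "\<And>t. integrable M (\<lambda>x. V x * max 0 (Z x - t))"
    and W: "integrable M W" "\<And>x. 0 \<le> W x" "\<And>t. integrable M (\<lambda>x. W x * max 0 (Z x - t))"
    and Z[measurable]: "Z \<in> borel_measurable M"
    and eq: "\<And>t. (\<integral>x. V x * indicator {t..} (Z x) \<partial>M) * (\<integral>x. W x * max 0 (Z x - t) \<partial>M) =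
      (\<integral>x. W x * indicator {t..} (Z x) \<partial>M) * (\<integral>x. V x * max 0 (Z x - t) \<partial>M)"
  shows "(\<integral>x. V x * indicator {t..} (Z x) \<partial>M) * (\<integral>x. W x \<partial>M) =
    (\<integral>x. W x * indicator {t..} (Z x) \<partial>M) * (\<integral>x. V x \<partial>M)"
proof -
  let ?T = "\<lambda>V t. \<integral>x. V x * indicator {t..} (Z x) \<partial>M"
  have total: "(\<lambda>n. ?T U (- real n)) \<longlonglongrightarrow> (\<integral>x. U x \<partial>M)" if U: "integrable M U" for U :: "'a \<Rightarrow> real"
  proof -
    have "?T U s = (\<integral>x. U x * indicator {x \<in> space M. s \<le> Z x} x \<partial>M)" for s
      by (intro Bochner_Integration.integral_cong refl) (auto simp: indicator_def)
    moreover have "(\<integral>x. U x \<partial>M) = (\<integral>x. U x * indicator (space M) x \<partial>M)"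
      by (intro Bochner_Integration.integral_cong refl) auto
    moreover have "eventually (\<lambda>n. - real n \<le> Z x) sequentially" for x
      using eventually_ge_at_top[of "nat \<lceil>- Z x\<rceil>"] by (rule eventually_mono) linarith
    ultimately show ?thesis
      using U by (auto intro!: tendsto_integral_mult_indicator elim: eventually_mono)
  qed
  have "?T V t * ?T W s = ?T W t * ?T V s" for s
    using integrated_tails_proportional[OF integrated_tail_expectation[OF V(1,2) Z V(3)]
        integrated_tail_expectation[OF W(1,2) Z W(3)] eq, of t s]
    by (simp add: mult.commute)
  then have "(\<lambda>n. ?T V t * ?T W (- real n)) \<longlonglongrightarrow> ?T W t * (\<integral>x. V x \<partial>M)"
    by (simp only:) (intro tendsto_mult_left total V)
  moreover have "(\<lambda>n. ?T V t * ?T W (- real n)) \<longlonglongrightarrow> ?T V t * (\<integral>x. W x \<partial>M)"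
    by (intro tendsto_mult_left total W)
  ultimately show ?thesis
    using LIMSEQ_unique by blast
qed

section \<open>From vanishing covariances on quadrants to independence\<close>

text \<open>
  Two applications of the one-variable result: to \<open>Y\<close> with weights \<open>w 1{X \<ge> s}\<close> and \<open>w (X-s)\<^sup>+\<close>, then
  to \<open>X\<close> with weights \<open>w\<close> and \<open>w 1{Y \<ge> t}\<close>. The conclusion is independence of the events
  \<open>{X \<ge> s}\<close> and \<open>{Y \<ge> t}\<close> under the normalised measure with density \<open>w\<close>.
\<close>
lemma tails_factor_if_shifted_products_factor:
  fixes w X Y :: "'a \<Rightarrow> real"
  assumes w: "integrable M w" "\<And>x. 0 \<le> w x"
    and [measurable]: "X \<in> borel_measurable M" "Y \<in> borel_measurable M"
    and X: "\<And>s. integrable M (\<lambda>x. w x * max 0 (X x - s))"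
    and Y: "\<And>t. integrable M (\<lambda>x. w x * max 0 (Y x - t))"
    and XY: "\<And>s t. integrable M (\<lambda>x. w x * max 0 (X x - s) * max 0 (Y x - t))"
    and eq: "\<And>s t. (\<integral>x. w x * indicator {s..} (X x) * indicator {t..} (Y x) \<partial>M) *
        (\<integral>x. w x * max 0 (X x - s) * max 0 (Y x - t) \<partial>M) =
      (\<integral>x. w x * max 0 (X x - s) * indicator {t..} (Y x) \<partial>M) *
        (\<integral>x. w x * indicator {s..} (X x) * max 0 (Y x - t) \<partial>M)"
  shows "(\<integral>x. w x * indicator {s..} (X x) * indicator {t..} (Y x) \<partial>M) * (\<integral>x. w x \<partial>M) =
    (\<integral>x. w x * indicator {s..} (X x) \<partial>M) * (\<integral>x. w x * indicator {t..} (Y x) \<partial>M)"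
proof -
  note [measurable] = borel_measurable_integrable[OF w(1)]
  have w_ind: "integrable M (\<lambda>x. w x * indicator {s..} (X x))" for s
    by (rule Bochner_Integration.integrable_bound[OF w(1)]) (auto simp: indicator_def)
  have w_ind': "integrable M (\<lambda>x. w x * indicator {t..} (Y x))" for t
    by (rule Bochner_Integration.integrable_bound[OF w(1)]) (auto simp: indicator_def)
  have Y_ind: "integrable M (\<lambda>x. w x * indicator {s..} (X x) * max 0 (Y x - t))" for s t
    by (rule Bochner_Integration.integrable_bound[OF Y[of t]]) (auto simp: indicator_def)
  have X_ind: "integrable M (\<lambda>x. w x * indicator {t..} (Y x) * max 0 (X x - s))" for s t
    by (rule Bochner_Integration.integrable_bound[OF X[of s]]) (auto simp: indicator_def)
  have stage1: "(\<integral>x. w x * indicator {s..} (X x) * indicator {t..} (Y x) \<partial>M) *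
        (\<integral>x. w x * max 0 (X x - s) \<partial>M) =
      (\<integral>x. w x * max 0 (X x - s) * indicator {t..} (Y x) \<partial>M) *
        (\<integral>x. w x * indicator {s..} (X x) \<partial>M)" for s t
    by (rule tail_expectations_proportional[OF w_ind _ Y_ind X _ XY])
       (use w(2) eq in auto)
  have "(\<integral>x. w x * indicator {s..} (X x) \<partial>M) * (\<integral>x. w x * indicator {t..} (Y x) \<partial>M) =
      (\<integral>x. w x * indicator {t..} (Y x) * indicator {s..} (X x) \<partial>M) * (\<integral>x. w x \<partial>M)"
  proof (rule tail_expectations_proportional[OF w X w_ind' _ X_ind])
    show "(\<integral>x. w x * indicator {s..} (X x) \<partial>M) *
        (\<integral>x. w x * indicator {t..} (Y x) * max 0 (X x - s) \<partial>M) =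
      (\<integral>x. w x * indicator {t..} (Y x) * indicator {s..} (X x) \<partial>M) *
        (\<integral>x. w x * max 0 (X x - s) \<partial>M)" for s
      using stage1[of s t] by (simp add: mult_ac)
  qed (use w(2) in auto)
  then show ?thesis
    by (simp add: mult_ac)
qed

lemma max_0_diff_eq:
  fixes z r :: real
  shows "max 0 (z - r) = (z - r) * indicator {r..} z"
  by (auto simp: indicator_def max_def)

context prob_space
begin

lemma prob_eq_expectation:
  assumes "U \<in> events" "\<And>x. x \<in> space M \<Longrightarrow> indicator U x = f x"
  shows "prob U = expectation f"
proof -
  have "expectation f = expectation (indicator U)"
    using assms(2) by (intro Bochner_Integration.integral_cong) auto
  also have "\<dots> = prob U"
    using sets.sets_into_space[OF assms(1)] by (simp add: Int_absorb2)
  finally show ?thesis ..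
qed

lemma indep_var_if_tails_factor:
  fixes X Y :: "'a \<Rightarrow> real"
  assumes X[measurable]: "X \<in> borel_measurable M" and Y[measurable]: "Y \<in> borel_measurable M"
    and eq: "\<And>s t. expectation (\<lambda>x. indicator {s..} (X x) * indicator {t..} (Y x)) =
      expectation (\<lambda>x. indicator {s..} (X x)) * expectation (\<lambda>x. indicator {t..} (Y x) :: real)"
  shows "indep_var borel X borel Y"
proof -
  let ?G = "\<lambda>Z :: 'a \<Rightarrow> real. {Z -` A \<inter> space M | A. A \<in> range atLeast}"
  have gen: "sigma_sets (space M) {Z -` A \<inter> space M | A. A \<in> sets borel} =
      sigma_sets (space M) (?G Z)" for Z :: "'a \<Rightarrow> real"
  proof -
    have "sigma_sets (space M) (?G Z) =
        {Z -` A \<inter> space M | A. A \<in> sigma_sets UNIV (range atLeast)}"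
      using sigma_sets_vimage_commute[of Z "space M" UNIV "range atLeast"] by auto
    also have "sigma_sets UNIV (range atLeast) = sets (borel :: real measure)"
      by (subst borel_Ici) (simp add: sets_measure_of)
    finally have *: "sigma_sets (space M) (?G Z) = {Z -` A \<inter> space M | A. A \<in> sets borel}" .
    show ?thesis
      unfolding *[symmetric] by (rule sigma_sets_sigma_sets_eq) auto
  qed
  have stable: "Int_stable (?G Z)" for Z
  proof (rule Int_stableI)
    fix a b assume "a \<in> ?G Z" "b \<in> ?G Z"
    then obtain s t where "a = Z -` {s..} \<inter> space M" "b = Z -` {t..} \<inter> space M"
      by blast
    then have "a \<inter> b = Z -` {max s t..} \<inter> space M" by auto
    then show "a \<inter> b \<in> ?G Z" by blast
  qed
  have "indep_set (?G X) (?G Y)"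
  proof (rule indep_setI)
    fix a b assume "a \<in> ?G X" "b \<in> ?G Y"
    then obtain s t where ab: "a = X -` {s..} \<inter> space M" "b = Y -` {t..} \<inter> space M"
      by blast
    have [measurable]: "a \<in> events" "b \<in> events"
      unfolding ab by measurable
    have "prob (a \<inter> b) = expectation (\<lambda>x. indicator {s..} (X x) * indicator {t..} (Y x))"
      by (rule prob_eq_expectation) (auto simp: ab indicator_def)
    moreover have "prob a = expectation (\<lambda>x. indicator {s..} (X x))"
      by (rule prob_eq_expectation) (auto simp: ab indicator_def)
    moreover have "prob b = expectation (\<lambda>x. indicator {t..} (Y x))"
      by (rule prob_eq_expectation) (auto simp: ab indicator_def)
    ultimately show "prob (a \<inter> b) = prob a * prob b"
      by (simp add: eq)
  qed auto
  then show ?thesis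
    unfolding indep_var_eq gen using X Y by (auto intro!: indep_set_sigma_sets stable)
qed

lemma indicator_rect_event:
  "x \<in> space M \<Longrightarrow> indicator (rect_event M X Y A B) x = (indicator A (X x) * indicator B (Y x) :: real)"
  by (simp add: rect_event_def indicator_def)

lemma integrable_shifted_product:
  fixes X Y :: "'a \<Rightarrow> real"
  assumes [measurable]: "U \<in> events"
    and X: "integrable M (\<lambda>x. X x * indicator U x)"
    and Y: "integrable M (\<lambda>x. Y x * indicator U x)"
    and XY: "integrable M (\<lambda>x. X x * Y x * indicator U x)"
  shows "integrable M (\<lambda>x. (X x - s) * (Y x - t) * indicator U x)"
    and "expectation (\<lambda>x. (X x - s) * (Y x - t) * indicator U x) =
      expectation (\<lambda>x. X x * Y x * indicator U x) - t * expectation (\<lambda>x. X x * indicator U x)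
      - s * expectation (\<lambda>x. Y x * indicator U x) + s * t * prob U"
proof -
  have "integrable M (\<lambda>x. indicator U x :: real)"
    by (rule integrable_const_bound[where B = 1]) (auto simp: indicator_def)
  moreover have "(X x - s) * (Y x - t) * indicator U x = X x * Y x * indicator U x
      - t * (X x * indicator U x) - s * (Y x * indicator U x) + s * t * indicator U x" for x
    by (simp add: algebra_simps)
  ultimately show "integrable M (\<lambda>x. (X x - s) * (Y x - t) * indicator U x)"
    and "expectation (\<lambda>x. (X x - s) * (Y x - t) * indicator U x) =
      expectation (\<lambda>x. X x * Y x * indicator U x) - t * expectation (\<lambda>x. X x * indicator U x)
      - s * expectation (\<lambda>x. Y x * indicator U x) + s * t * prob U"
    using X Y XY by simp_all
qed

text \<open>
  Covariances are invariant under shifts. Without denominators the identity also holds,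
  trivially, when \<open>U\<close> is a null event.
\<close>
lemma shifted_products_factor_on_event:
  fixes X Y :: "'a \<Rightarrow> real"
  assumes [measurable]: "X \<in> borel_measurable M" "Y \<in> borel_measurable M" "U \<in> events"
    and X: "integrable M (\<lambda>x. X x * indicator U x)"
    and Y: "integrable M (\<lambda>x. Y x * indicator U x)"
    and XY: "integrable M (\<lambda>x. X x * Y x * indicator U x)"
    and uncorrelated: "prob U > 0 \<Longrightarrow>
      event_cond_exp M (\<lambda>x. X x * Y x) U = event_cond_exp M X U * event_cond_exp M Y U"
  shows "prob U * expectation (\<lambda>x. (X x - s) * (Y x - t) * indicator U x) =
    expectation (\<lambda>x. (X x - s) * indicator U x) * expectation (\<lambda>x. (Y x - t) * indicator U x)"
proof (cases "prob U > 0")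
  case True
  let ?X = "expectation (\<lambda>x. X x * indicator U x)" and ?Y = "expectation (\<lambda>x. Y x * indicator U x)"
    and ?XY = "expectation (\<lambda>x. X x * Y x * indicator U x)"
  have 1: "integrable M (\<lambda>x. indicator U x :: real)"
    by (rule integrable_const_bound[where B = 1]) (auto simp: indicator_def)
  have product: "prob U * ?XY = ?X * ?Y"
    using uncorrelated[OF True] True by (simp add: event_cond_exp_eq field_simps power2_eq_square)
  have shift_X: "expectation (\<lambda>x. (X x - s) * indicator U x) = ?X - s * prob U"
    using X 1 by (simp add: left_diff_distrib)
  have shift_Y: "expectation (\<lambda>x. (Y x - t) * indicator U x) = ?Y - t * prob U"
    using Y 1 by (simp add: left_diff_distrib)
  show ?thesis
    unfolding shift_X shift_Y integrable_shifted_product(2)[OF assms(3) X Y XY] using product by algebra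
next
  case False
  then have "prob U = 0"
    using measure_nonneg[of M U] by linarith
  then have "AE x in M. x \<notin> U"
    by (simp add: prob_eq_0)
  then have "expectation (\<lambda>x. (X x - s) * indicator U x) = 0"
    by (intro integral_eq_zero_AE) (auto elim: eventually_mono)
  then show ?thesis
    using \<open>prob U = 0\<close> by simp
qed

section \<open>Rectangles with bounded and half-bounded sides\<close>

lemma uncorrelated_on_rect_if_indep:
  fixes X Y :: "'a \<Rightarrow> real"
  assumes indep: "indep_var borel X borel Y"
    and [measurable]: "A \<in> sets borel" "B \<in> sets borel"
    and X: "integrable M (\<lambda>x. X x * indicator A (X x))"
    and Y: "integrable M (\<lambda>x. Y x * indicator B (Y x))"
    and pos: "prob (rect_event M X Y A B) > 0"
  shows "integrable (uniform_measure M (rect_event M X Y A B)) (\<lambda>x. X x * Y x)"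
    and "event_cond_exp M (\<lambda>x. X x * Y x) (rect_event M X Y A B) =
      event_cond_exp M X (rect_event M X Y A B) * event_cond_exp M Y (rect_event M X Y A B)"
proof -
  let ?U = "rect_event M X Y A B"
  let ?a = "\<lambda>x. indicator A (X x) :: real" and ?b = "\<lambda>x. indicator B (Y x) :: real"
  have [measurable]: "X \<in> borel_measurable M" "Y \<in> borel_measurable M"
    using indep_var_rv1[OF indep] indep_var_rv2[OF indep] .
  have [measurable]: "?U \<in> events"
    unfolding rect_event_def by measurable
  have a: "integrable M ?a" and b: "integrable M ?b"
    by (auto intro!: integrable_const_bound[where B = 1] simp: indicator_def)
  have ind: "indep_var borel (\<lambda>x. f (X x)) borel (\<lambda>x. g (Y x))"
    if "f \<in> borel_measurable borel" "g \<in> borel_measurable borel" for f g :: "real \<Rightarrow> real"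
    using indep_var_compose[OF indep that] by (simp add: comp_def)
  have "indep_var borel (\<lambda>x. X x * ?a x) borel (\<lambda>x. Y x * ?b x)"
    by (rule ind[of "\<lambda>x. x * indicator A x" "\<lambda>x. x * indicator B x"]) measurable
  note XY = indep_var_lebesgue_integral[OF this X Y] indep_var_integrable[OF this X Y]
  have "indep_var borel (\<lambda>x. X x * ?a x) borel ?b"
    by (rule ind[of "\<lambda>x. x * indicator A x" "\<lambda>x. indicator B x"]) measurable
  note Xb = indep_var_lebesgue_integral[OF this X b]
  have "indep_var borel ?a borel (\<lambda>x. Y x * ?b x)"
    by (rule ind[of "\<lambda>x. indicator A x" "\<lambda>x. x * indicator B x"]) measurable
  note aY = indep_var_lebesgue_integral[OF this a Y]
  have "indep_var borel ?a borel ?b"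
    by (rule ind) measurable
  note ab = indep_var_lebesgue_integral[OF this a b]
  have "integrable M (\<lambda>x. X x * Y x * indicator ?U x)"
    using XY(2) by (rule back_subst[of "\<lambda>P. P"], intro Bochner_Integration.integrable_cong refl)
      (simp add: indicator_rect_event mult_ac)
  then have "integrable M (\<lambda>x. \<bar>X x * Y x * indicator ?U x\<bar>)"
    by (rule integrable_abs)
  then show "integrable (uniform_measure M ?U) (\<lambda>x. X x * Y x)"
    by (subst integrable_uniform_measure_iff[OF pos]) (auto simp: abs_mult)
  have "expectation (\<lambda>x. X x * Y x * indicator ?U x) = expectation (\<lambda>x. X x * ?a x * (Y x * ?b x))"
    by (intro Bochner_Integration.integral_cong refl) (simp add: indicator_rect_event mult_ac)
  moreover have "expectation (\<lambda>x. X x * indicator ?U x) = expectation (\<lambda>x. X x * ?a x * ?b x)"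
    by (intro Bochner_Integration.integral_cong refl) (simp add: indicator_rect_event mult_ac)
  moreover have "expectation (\<lambda>x. Y x * indicator ?U x) = expectation (\<lambda>x. ?a x * (Y x * ?b x))"
    by (intro Bochner_Integration.integral_cong refl) (simp add: indicator_rect_event mult_ac)
  moreover have p: "prob ?U = expectation (\<lambda>x. ?a x * ?b x)"
    by (rule prob_eq_expectation) (simp_all add: indicator_rect_event)
  moreover have "expectation ?a \<noteq> 0" "expectation ?b \<noteq> 0"
    using pos unfolding p ab by auto
  ultimately show "event_cond_exp M (\<lambda>x. X x * Y x) ?U = event_cond_exp M X ?U * event_cond_exp M Y ?U"
    using pos by (simp add: event_cond_exp_eq XY(1) Xb aY ab)
qed

lemma indep_var_if_uncorrelated_on_half_bounded:
  fixes X Y :: "'a \<Rightarrow> real"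
  assumes X: "integrable M X" and Y: "integrable M Y"
    and uncorrelated: "\<And>s t. prob (rect_event M X Y {s..} {t..}) > 0 \<Longrightarrow>
      integrable (uniform_measure M (rect_event M X Y {s..} {t..})) (\<lambda>x. X x * Y x) \<and>
      event_cond_exp M (\<lambda>x. X x * Y x) (rect_event M X Y {s..} {t..}) =
        event_cond_exp M X (rect_event M X Y {s..} {t..}) *
        event_cond_exp M Y (rect_event M X Y {s..} {t..})"
  shows "indep_var borel X borel Y"
proof -
  note [measurable] = borel_measurable_integrable[OF X] borel_measurable_integrable[OF Y]
  let ?U = "\<lambda>s t. rect_event M X Y {s..} {t..}"
  have U[measurable]: "?U s t \<in> events" for s t
    unfolding rect_event_def by measurable
  have XY: "integrable M (\<lambda>x. X x * Y x * indicator (?U s t) x)" for s t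
  proof (cases "prob (?U s t) > 0")
    case True
    then have "integrable M (\<lambda>x. \<bar>X x * Y x\<bar> * indicator (?U s t) x)"
      using uncorrelated[of s t] integrable_uniform_measure_iff[OF True, of "\<lambda>x. X x * Y x"]
      by simp
    then show ?thesis
      by (rule Bochner_Integration.integrable_bound) (auto simp: abs_mult)
  next
    case False
    then have "prob (?U s t) = 0"
      using measure_nonneg[of M "?U s t"] by linarith
    then have "AE x in M. x \<notin> ?U s t"
      by (simp add: prob_eq_0)
    then have "AE x in M. X x * Y x * indicator (?U s t) x = 0"
      by (auto elim: eventually_mono)
    then show ?thesis
      by (subst integrable_cong_AE[where g = "\<lambda>x. 0"]) auto
  qed
  have X1: "integrable M (\<lambda>x. X x * indicator (?U s t) x)" for s t
    by (rule Bochner_Integration.integrable_bound[OF X]) (auto simp: indicator_def)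
  have Y1: "integrable M (\<lambda>x. Y x * indicator (?U s t) x)" for s t
    by (rule Bochner_Integration.integrable_bound[OF Y]) (auto simp: indicator_def)
  have conv:
    "(X x - s) * (Y x - t) * indicator (?U s t) x = max 0 (X x - s) * max 0 (Y x - t)"
    "(X x - s) * indicator (?U s t) x = max 0 (X x - s) * indicator {t..} (Y x)"
    "(Y x - t) * indicator (?U s t) x = indicator {s..} (X x) * max 0 (Y x - t)"
    if "x \<in> space M" for x s t
    using that by (simp_all add: indicator_rect_event max_0_diff_eq mult_ac)
  have eq: "expectation (\<lambda>x. indicator {s..} (X x) * indicator {t..} (Y x)) *
        expectation (\<lambda>x. max 0 (X x - s) * max 0 (Y x - t)) =
      expectation (\<lambda>x. max 0 (X x - s) * indicator {t..} (Y x)) *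
        expectation (\<lambda>x. indicator {s..} (X x) * max 0 (Y x - t))" for s t
  proof -
    have "prob (?U s t) = expectation (\<lambda>x. indicator {s..} (X x) * indicator {t..} (Y x))"
      by (rule prob_eq_expectation) (simp_all add: indicator_rect_event)
    then show ?thesis
      using shifted_products_factor_on_event[OF _ _ U X1 Y1 XY, of s t s t] uncorrelated[of s t]
      by (simp add: conv cong: Bochner_Integration.integral_cong)
  qed
  have "expectation (\<lambda>x. (1 :: real) * indicator {s..} (X x) * indicator {t..} (Y x)) * expectation (\<lambda>x. 1 :: real) =
      expectation (\<lambda>x. 1 * indicator {s..} (X x)) * expectation (\<lambda>x. 1 * indicator {t..} (Y x))" for s t
  proof (rule tails_factor_if_shifted_products_factor)
    fix s t
    have "integrable M (\<lambda>x. (X x - s) * (Y x - t) * indicator (?U s t) x)"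
      by (rule integrable_shifted_product[OF U X1 Y1 XY])
    then show "integrable M (\<lambda>x. 1 * max 0 (X x - s) * max 0 (Y x - t))"
      by (simp add: conv cong: Bochner_Integration.integrable_cong)
  qed (use X Y eq in auto)
  then show ?thesis
    by (intro indep_var_if_tails_factor) (auto simp: prob_space)
qed

text \<open>
  On \<open>{X \<le> n, Y \<le> n}\<close> the variables \<open>(X-s)\<^sup>+\<close> and \<open>(Y-t)\<^sup>+\<close> are bounded, and quadrants become
  bounded rectangles. The argument for quadrants, weighted by the indicator of this event,
  shows that \<open>X\<close> and \<open>Y\<close> are conditionally independent given the event, if its probability is
  positive; independence follows as \<open>n\<close> tends to infinity.
\<close>
lemma indep_var_if_uncorrelated_on_bounded:
  fixes X Y :: "'a \<Rightarrow> real"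
  assumes [measurable]: "X \<in> borel_measurable M" "Y \<in> borel_measurable M"
    and uncorrelated: "\<And>a b c d. a < b \<Longrightarrow> c < d \<Longrightarrow> prob (rect_event M X Y {a..b} {c..d}) > 0 \<Longrightarrow>
      event_cond_exp M (\<lambda>x. X x * Y x) (rect_event M X Y {a..b} {c..d}) =
        event_cond_exp M X (rect_event M X Y {a..b} {c..d}) *
        event_cond_exp M Y (rect_event M X Y {a..b} {c..d})"
  shows "indep_var borel X borel Y"
proof -
  define w :: "real \<Rightarrow> 'a \<Rightarrow> real" where "w n x = indicator {..n} (X x) * indicator {..n} (Y x)" for n x
  have w[measurable]: "w n \<in> borel_measurable M" for n
    unfolding w_def by measurable
  have w_cases: "w n x = 0 \<or> w n x = 1 \<and> X x \<le> n \<and> Y x \<le> n" for n x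
    by (auto simp: w_def indicator_def)
  have clip_bound: "\<bar>w n x * max 0 (X x - s)\<bar> \<le> max 0 (n - s)"
      "\<bar>w n x * max 0 (Y x - s)\<bar> \<le> max 0 (n - s)" for n x s
    using w_cases[of n x] by (auto simp: max_def)
  have factor: "expectation (\<lambda>x. w n x * indicator {s..} (X x) * indicator {t..} (Y x)) *
        expectation (w n) =
      expectation (\<lambda>x. w n x * indicator {s..} (X x)) * expectation (\<lambda>x. w n x * indicator {t..} (Y x))"
    for n s t
  proof (rule tails_factor_if_shifted_products_factor)
    show "integrable M (w n)"
      by (rule integrable_const_bound[where B = 1]) (auto simp: w_def indicator_def)
    show "0 \<le> w n x" for x
      using w_cases[of n x] by auto
    show "integrable M (\<lambda>x. w n x * max 0 (X x - s))" for s
      using clip_bound by (intro integrable_const_bound[where B = "max 0 (n - s)"]) auto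
    show "integrable M (\<lambda>x. w n x * max 0 (Y x - s))" for s
      using clip_bound by (intro integrable_const_bound[where B = "max 0 (n - s)"]) auto
    show "integrable M (\<lambda>x. w n x * max 0 (X x - s) * max 0 (Y x - t))" for s t
    proof (intro integrable_const_bound[where B = "max 0 (n - s) * max 0 (n - t)"] AE_I2)
      fix x
      show "norm (w n x * max 0 (X x - s) * max 0 (Y x - t)) \<le> max 0 (n - s) * max 0 (n - t)"
        using w_cases[of n x]
        by (cases "w n x = 0") (auto simp: abs_mult intro!: mult_mono)
    qed measurable
    fix s t
    let ?U = "rect_event M X Y {s..n} {t..n}"
    have U[measurable]: "?U \<in> events"
      unfolding rect_event_def by measurable
    have cut: "indicator {r..n} z = (indicator {..n} z * indicator {r..} z :: real)" for r z
      by (auto simp: indicator_def)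
    have conv:
      "(X x - s) * (Y x - t) * indicator ?U x = w n x * max 0 (X x - s) * max 0 (Y x - t)"
      "(X x - s) * indicator ?U x = w n x * max 0 (X x - s) * indicator {t..} (Y x)"
      "(Y x - t) * indicator ?U x = w n x * indicator {s..} (X x) * max 0 (Y x - t)"
      "indicator ?U x = w n x * indicator {s..} (X x) * indicator {t..} (Y x)"
      if "x \<in> space M" for x
      using that by (simp_all add: indicator_rect_event w_def cut max_0_diff_eq mult_ac)
    have "prob ?U * expectation (\<lambda>x. (X x - s) * (Y x - t) * indicator ?U x) =
      expectation (\<lambda>x. (X x - s) * indicator ?U x) * expectation (\<lambda>x. (Y x - t) * indicator ?U x)"
    proof (cases "s < n \<and> t < n")
      case True
      define C where "C = \<bar>s\<bar> + \<bar>t\<bar> + \<bar>n\<bar>"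
      have bound: "\<bar>X x\<bar> \<le> C" "\<bar>Y x\<bar> \<le> C" if "x \<in> ?U" for x
        using that by (auto simp: rect_event_def C_def)
      have C: "0 \<le> C"
        by (simp add: C_def)
      show ?thesis
      proof (rule shifted_products_factor_on_event)
        show "integrable M (\<lambda>x. X x * indicator ?U x)" "integrable M (\<lambda>x. Y x * indicator ?U x)"
          using bound C by (auto intro!: integrable_const_bound[where B = C] split: split_indicator)
        show "integrable M (\<lambda>x. X x * Y x * indicator ?U x)"
        proof (rule integrable_const_bound[where B = "C * C"], rule AE_I2)
          fix x
          show "norm (X x * Y x * indicator ?U x) \<le> C * C"
            using bound[of x] C by (auto simp: abs_mult intro!: mult_mono split: split_indicator)
        qed measurable
      qed (use True uncorrelated in auto)
    next
      \<comment> \<open>A side of the rectangle is empty or a single point, so one of the shifted variables vanishes on it.\<close>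
      case False
      then have "(\<forall>x. (X x - s) * indicator ?U x = 0) \<or> (\<forall>x. (Y x - t) * indicator ?U x = 0)"
        by (auto simp: rect_event_def indicator_def)
      then have one: "expectation (\<lambda>x. (X x - s) * indicator ?U x) *
          expectation (\<lambda>x. (Y x - t) * indicator ?U x) = 0"
        by (elim disjE) (simp_all only: integral_zero mult_zero_left mult_zero_right)
      have "(X x - s) * (Y x - t) * indicator ?U x = 0" for x
        using False by (auto simp: rect_event_def indicator_def)
      then show ?thesis
        by (simp only: one integral_zero mult_zero_right)
    qed
    moreover have "prob ?U = expectation (\<lambda>x. w n x * indicator {s..} (X x) * indicator {t..} (Y x))"
      by (rule prob_eq_expectation) (simp_all add: conv)
    ultimately show "expectation (\<lambda>x. w n x * indicator {s..} (X x) * indicator {t..} (Y x)) *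
        expectation (\<lambda>x. w n x * max 0 (X x - s) * max 0 (Y x - t)) =
      expectation (\<lambda>x. w n x * max 0 (X x - s) * indicator {t..} (Y x)) *
        expectation (\<lambda>x. w n x * indicator {s..} (X x) * max 0 (Y x - t))"
      by (simp add: conv(1-3) cong: Bochner_Integration.integral_cong)
  qed measurable
  have lim: "(\<lambda>n. expectation (\<lambda>x. w (real n) x * V x)) \<longlonglongrightarrow> expectation V" if V: "integrable M V" for V
  proof -
    have "expectation (\<lambda>x. w n x * V x) =
        expectation (\<lambda>x. V x * indicator (rect_event M X Y {..n} {..n}) x)" for n
      by (intro Bochner_Integration.integral_cong refl) (simp add: indicator_rect_event w_def)
    moreover have "expectation V = expectation (\<lambda>x. V x * indicator (space M) x)"
      by (intro Bochner_Integration.integral_cong refl) simp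
    moreover have "(\<lambda>n. expectation (\<lambda>x. V x * indicator (rect_event M X Y {..real n} {..real n}) x))
        \<longlonglongrightarrow> expectation (\<lambda>x. V x * indicator (space M) x)"
    proof (rule tendsto_integral_mult_indicator[OF V])
      show "rect_event M X Y {..real n} {..real n} \<in> events" for n
        unfolding rect_event_def by measurable
      fix x assume "x \<in> space M"
      have "eventually (\<lambda>n. X x \<le> real n \<and> Y x \<le> real n) sequentially"
        using eventually_ge_at_top[of "nat \<lceil>max (X x) (Y x)\<rceil>"] by (rule eventually_mono) linarith
      then show "eventually (\<lambda>n. x \<in> rect_event M X Y {..real n} {..real n} \<longleftrightarrow> x \<in> space M) sequentially"
        using \<open>x \<in> space M\<close> by (auto simp: rect_event_def elim: eventually_mono)
    qed simp
    ultimately show ?thesis by simp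
  qed
  show ?thesis
  proof (rule indep_var_if_tails_factor)
    fix s t
    let ?a = "\<lambda>x. indicator {s..} (X x) :: real" and ?b = "\<lambda>x. indicator {t..} (Y x) :: real"
    have int: "integrable M ?a" "integrable M ?b" "integrable M (\<lambda>x. ?a x * ?b x)"
      by (auto intro!: integrable_const_bound[where B = 1] simp: indicator_def)
    have "(\<lambda>n. expectation (\<lambda>x. w (real n) x * (?a x * ?b x)) * expectation (\<lambda>x. w (real n) x * 1))
        \<longlonglongrightarrow> expectation (\<lambda>x. ?a x * ?b x) * expectation (\<lambda>x. 1)"
      by (intro tendsto_mult lim int) simp
    moreover have "(\<lambda>n. expectation (\<lambda>x. w (real n) x * ?a x) * expectation (\<lambda>x. w (real n) x * ?b x))
        \<longlonglongrightarrow> expectation ?a * expectation ?b"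
      by (intro tendsto_mult lim int)
    ultimately show "expectation (\<lambda>x. ?a x * ?b x) = expectation ?a * expectation ?b"
      using factor[of "real _" s t] LIMSEQ_unique by (simp add: prob_space mult.assoc) blast
  qed measurable
qed

end

theorem theorem4:
  fixes M :: "'a measure" and X Y :: "'a \<Rightarrow> real"
  assumes "prob_space M"
    and "X \<in> borel_measurable M" and "Y \<in> borel_measurable M"
  shows "(prob_space.indep_var M borel X borel Y \<longleftrightarrow>
          (\<forall>A\<in>bounded_intervals. \<forall>B\<in>bounded_intervals.
             measure M (rect_event M X Y A B) > 0 \<longrightarrow>
             event_cond_exp M (\<lambda>\<omega>. X \<omega> * Y \<omega>) (rect_event M X Y A B) =
               event_cond_exp M X (rect_event M X Y A B) *
               event_cond_exp M Y (rect_event M X Y A B)))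
       \<and> (integrable M X \<and> integrable M Y \<longrightarrow>
          (prob_space.indep_var M borel X borel Y \<longleftrightarrow>
          (\<forall>A\<in>half_bounded_intervals. \<forall>B\<in>half_bounded_intervals.
             measure M (rect_event M X Y A B) > 0 \<longrightarrow>
             integrable (uniform_measure M (rect_event M X Y A B)) (\<lambda>\<omega>. X \<omega> * Y \<omega>) \<and>
             event_cond_exp M (\<lambda>\<omega>. X \<omega> * Y \<omega>) (rect_event M X Y A B) =
               event_cond_exp M X (rect_event M X Y A B) *
               event_cond_exp M Y (rect_event M X Y A B))))"
proof -
  interpret prob_space M by (rule assms(1))
  note [measurable] = assms(2,3)
  have bounded: "integrable M (\<lambda>x. Z x * indicator {a..b} (Z x))"
    if [measurable]: "Z \<in> borel_measurable M" for Z and a b :: real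
    by (rule integrable_const_bound[where B = "\<bar>a\<bar> + \<bar>b\<bar>"]) (auto split: split_indicator)
  have half: "integrable M (\<lambda>x. Z x * indicator {t..} (Z x))"
    if "integrable M Z" for Z and t :: real
    using that borel_measurable_integrable[OF that]
    by (intro Bochner_Integration.integrable_bound[OF that]) (auto split: split_indicator)
  show ?thesis
  proof (intro conjI impI iffI)
    assume "indep_var borel X borel Y"
    then show "\<forall>A\<in>bounded_intervals. \<forall>B\<in>bounded_intervals. prob (rect_event M X Y A B) > 0 \<longrightarrow>
        event_cond_exp M (\<lambda>\<omega>. X \<omega> * Y \<omega>) (rect_event M X Y A B) =
        event_cond_exp M X (rect_event M X Y A B) * event_cond_exp M Y (rect_event M X Y A B)"
      using assms(2,3) by (auto simp: bounded_intervals_def intro!: uncorrelated_on_rect_if_indep bounded)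
  next
    assume "\<forall>A\<in>bounded_intervals. \<forall>B\<in>bounded_intervals. prob (rect_event M X Y A B) > 0 \<longrightarrow>
        event_cond_exp M (\<lambda>\<omega>. X \<omega> * Y \<omega>) (rect_event M X Y A B) =
        event_cond_exp M X (rect_event M X Y A B) * event_cond_exp M Y (rect_event M X Y A B)"
    then show "indep_var borel X borel Y"
      by (intro indep_var_if_uncorrelated_on_bounded) (auto simp: bounded_intervals_def)
  next
    assume "integrable M X \<and> integrable M Y" and "indep_var borel X borel Y"
    then show "\<forall>A\<in>half_bounded_intervals. \<forall>B\<in>half_bounded_intervals.
        prob (rect_event M X Y A B) > 0 \<longrightarrow>
        integrable (uniform_measure M (rect_event M X Y A B)) (\<lambda>\<omega>. X \<omega> * Y \<omega>) \<and>
        event_cond_exp M (\<lambda>\<omega>. X \<omega> * Y \<omega>) (rect_event M X Y A B) =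
        event_cond_exp M X (rect_event M X Y A B) * event_cond_exp M Y (rect_event M X Y A B)"
      by (auto simp: half_bounded_intervals_def intro!: uncorrelated_on_rect_if_indep half)
  next
    assume "integrable M X \<and> integrable M Y"
      and "\<forall>A\<in>half_bounded_intervals. \<forall>B\<in>half_bounded_intervals.
        prob (rect_event M X Y A B) > 0 \<longrightarrow>
        integrable (uniform_measure M (rect_event M X Y A B)) (\<lambda>\<omega>. X \<omega> * Y \<omega>) \<and>
        event_cond_exp M (\<lambda>\<omega>. X \<omega> * Y \<omega>) (rect_event M X Y A B) =
        event_cond_exp M X (rect_event M X Y A B) * event_cond_exp M Y (rect_event M X Y A B)"
    then show "indep_var borel X borel Y"
      by (intro indep_var_if_uncorrelated_on_half_bounded) (auto simp: half_bounded_intervals_def)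
  qed
qed

end
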